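(* Let $L$ be a finite-dimensional (right) Leibniz algebra over a field of characteristic zero, let $R$ be its radical and let $N$ be its nilradical. Then $[L,R]\subseteq N$.
   Context: A (right) Leibniz algebra over a field $F$ is an $F$-vector space $L$ with a bilinear product $[\cdot,\cdot]$ satisfying $[x,[y,z]]=[[x,y],z]-[[x,z],y]$ for all $x,y,z\in L$; equivalently, each right multiplication $R_x:L\to L$, $y\mapsto [y,x]$, is a derivation. Ideals are two-sided. For subspaces $A,C$ of $L$, $[A,C]$ denotes the linear span of all products $[a,c]$ with $a\in A$, $c\in C$. Put $L^1=L$, $L^{k+1}=[L^k,L]$ and $L^{(1)}=L$, $L^{(k+1)}=[L^{(k)},L^{(k)}]$ for $k\ge 1$. $L$ is nilpotent (resp. solvable) if $L^n=0$ (resp. $L^{(n)}=0$) for some $n\in\mathbb{N}$. The nilradical (resp. radical) of $L$ is the largest nilpotent (resp. solvable) ideal of $L$. *)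

theory Defs
  imports Complex_Main
begin

locale right_leibniz_algebra = vector_space scale
  for scale :: "'f::field \<Rightarrow> 'v::ab_group_add \<Rightarrow> 'v" +
  fixes bracket :: "'v \<Rightarrow> 'v \<Rightarrow> 'v"
  assumes linear_left: "Vector_Spaces.linear scale scale (\<lambda>x. bracket x y)"
    and linear_right: "Vector_Spaces.linear scale scale (\<lambda>y. bracket x y)"
    and leibniz: "bracket x (bracket y z) = bracket (bracket x y) z - bracket (bracket x z) y"
begin

definition ideal :: "'v set \<Rightarrow> bool" where
  "ideal I \<longleftrightarrow> subspace I \<and> (\<forall>a\<in>I. \<forall>x. bracket a x \<in> I \<and> bracket x a \<in> I)"

definition product :: "'v set \<Rightarrow> 'v set \<Rightarrow> 'v set" where
  "product A C = span {bracket a c | a c. a \<in> A \<and> c \<in> C}"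

text \<open>
  Both series are those of a subalgebra \<open>A\<close> regarded as an algebra in its own right.
  They are indexed from 0, whereas the usual superscripts start at 1: the term with index
  \<open>k\<close> is $A^{k+1}$, respectively $A^{(k+1)}$.
\<close>

primrec lower_central_series :: "'v set \<Rightarrow> nat \<Rightarrow> 'v set" where
  "lower_central_series A 0 = A"
| "lower_central_series A (Suc k) = product (lower_central_series A k) A"

primrec derived_series :: "'v set \<Rightarrow> nat \<Rightarrow> 'v set" where
  "derived_series A 0 = A"
| "derived_series A (Suc k) = product (derived_series A k) (derived_series A k)"

definition nilpotent :: "'v set \<Rightarrow> bool" where
  "nilpotent A \<longleftrightarrow> (\<exists>n. lower_central_series A n = {0})"

definition solvable :: "'v set \<Rightarrow> bool" where
  "solvable A \<longleftrightarrow> (\<exists>n. derived_series A n = {0})"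

text \<open>
  The greatest element is taken with respect to inclusion. It exists whenever the algebra is
  finite-dimensional; otherwise the value may be unspecified.
\<close>

definition nilradical :: "'v set" where
  "nilradical = (GREATEST I. ideal I \<and> nilpotent I)"

definition radical :: "'v set" where
  "radical = (GREATEST I. ideal I \<and> solvable I)"

end

end

theory Submission
  imports Defs "HOL-Computational_Algebra.Polynomial"
begin

text \<open>
  Let \<open>L\<close> act on itself by right multiplications and let \<open>M/U\<close> be a composition factor of this
  module. It suffices that \<open>I = [L, R]\<close> kills every \<open>M/U\<close>, since an ideal is nilpotent exactly
  when it does so. Going down the derived series of \<open>I\<close>, suppose that a term \<open>D\<close> acts on \<open>M/U\<close>
  by commuting maps. If \<open>c = [y, z]\<close> commutes with \<open>y\<close> and is surjective on a subquotient, then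
  differentiating an annihilating polynomial of \<open>y\<close> of least degree with respect to \<open>z\<close> gives
  an annihilating polynomial of smaller degree, so in characteristic zero the subquotient
  vanishes. Applied to \<open>c \<in> [D, L]\<close> this shows that \<open>c\<close> acts nilpotently, and simplicity gives
  that \<open>[D, L]\<close> kills \<open>M/U\<close>, so \<open>D\<close> is central. Since \<open>D\<close> is spanned by products, the same
  argument applied to these products shows that \<open>D\<close> itself kills \<open>M/U\<close>.
\<close>

section \<open>Polynomials in a linear operator\<close>

locale linear_operator = vector_space scale
  for scale :: "'a::field \<Rightarrow> 'b::ab_group_add \<Rightarrow> 'b" +
  fixes g :: "'b \<Rightarrow> 'b"
  assumes linear_operator: "Vector_Spaces.linear scale scale g"
begin

sublocale g: Vector_Spaces.linear scale scale g
  by (fact linear_operator)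

text \<open>The vector p(g) v, evaluated by Horner's scheme. The space thus becomes a module over
  the polynomial ring, with the indeterminate acting as \<open>g\<close>.\<close>

definition poly_map :: "'a poly \<Rightarrow> 'b \<Rightarrow> 'b" where
  "poly_map p v = fold_coeffs (\<lambda>a w. scale a v + g w) p 0"

lemma poly_map_0 [simp]: "poly_map 0 v = 0"
  by (simp add: poly_map_def)

lemma poly_map_pCons: "poly_map (pCons a p) v = scale a v + g (poly_map p v)"
  by (cases "p = 0 \<and> a = 0") (auto simp: poly_map_def)

lemma poly_map_add: "poly_map (p + q) v = poly_map p v + poly_map q v"
  by (induction p q rule: poly_induct2)
     (simp_all add: poly_map_pCons g.add algebra_simps)

lemma poly_map_smult: "poly_map (smult c p) v = scale c (poly_map p v)"
  by (induction p) (simp_all add: poly_map_pCons g.scale algebra_simps)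

lemma poly_map_diff: "poly_map (p - q) v = poly_map p v - poly_map q v"
  using poly_map_add[of "p - q" q v] by simp

lemma poly_map_mult: "poly_map (p * q) v = poly_map p (poly_map q v)"
  by (induction p) (simp_all add: poly_map_pCons poly_map_add poly_map_smult)

lemma poly_map_monom: "poly_map (monom 1 n) v = (g ^^ n) v"
  by (induction n) (simp_all add: monom_0 monom_Suc poly_map_pCons)

lemma linear_poly_map: "Vector_Spaces.linear scale scale (poly_map p)"
proof (rule Vector_Spaces.linear_iff[THEN iffD2], intro conjI allI vector_space_axioms)
  show "poly_map p (v + w) = poly_map p v + poly_map p w" for v w
    by (induction p) (simp_all add: poly_map_pCons g.add algebra_simps)
  show "poly_map p (scale c v) = scale c (poly_map p v)" for c v
    by (induction p) (simp_all add: poly_map_pCons g.scale algebra_simps)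
qed

lemma poly_map_in_subspace:
  assumes "subspace M" and "\<And>w. w \<in> M \<Longrightarrow> g w \<in> M" and "v \<in> M"
  shows "poly_map p v \<in> M"
  by (induction p)
     (auto simp: poly_map_pCons assms intro!: subspace_add subspace_scale subspace_0)

end

locale finite_dimensional_linear_operator =
  linear_operator scale g + finite_dimensional_vector_space scale Basis
  for scale :: "'a::field \<Rightarrow> 'b::ab_group_add \<Rightarrow> 'b" and g and Basis
begin

text \<open>Otherwise all iterates of \<open>g\<close> at \<open>v\<close> would be distinct and
  independent, exceeding the dimension.\<close>

lemma exists_annihilating_poly_at: "\<exists>p. p \<noteq> 0 \<and> poly_map p v = 0"
proof (rule ccontr)
  assume contr: "\<not> ?thesis"
  let ?K = "\<lambda>n. (\<lambda>i. (g ^^ i) v) ` {..<n}"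
  have "independent (?K n) \<and> card (?K n) = n" for n
  proof (induction n)
    case 0
    show ?case by (simp add: independent_empty)
  next
    case (Suc n)
    \<comment> \<open>The values at \<open>v\<close> of polynomials of degree below
      \<open>n\<close>. Bounding coefficients instead of \<open>degree\<close> makes this the zero
      space when \<open>n = 0\<close>.\<close>
    let ?T = "{poly_map p v | p. \<forall>i\<ge>n. coeff p i = 0}"
    have "subspace ?T"
    proof (rule subspaceI)
      show "0 \<in> ?T"
        by (auto intro!: exI[of _ 0])
      show "x + y \<in> ?T" if xy: "x \<in> ?T" "y \<in> ?T" for x y
      proof -
        obtain p q where "x = poly_map p v" "y = poly_map q v"
          "\<forall>i\<ge>n. coeff p i = 0" "\<forall>i\<ge>n. coeff q i = 0"
          using xy by auto
        then show ?thesis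
          by (auto simp: poly_map_add intro!: exI[of _ "p + q"])
      qed
      show "scale c x \<in> ?T" if x: "x \<in> ?T" for c x
      proof -
        obtain p where "x = poly_map p v" "\<forall>i\<ge>n. coeff p i = 0"
          using x by auto
        then show ?thesis
          by (auto simp: poly_map_smult intro!: exI[of _ "smult c p"])
      qed
    qed
    moreover have "?K n \<subseteq> ?T"
    proof clarify
      fix i assume "i < n"
      then show "\<exists>p. (g ^^ i) v = poly_map p v \<and> (\<forall>i\<ge>n. coeff p i = 0)"
        by (auto simp: poly_map_monom coeff_monom intro!: exI[of _ "monom 1 i"])
    qed
    ultimately have span: "span (?K n) \<subseteq> ?T"
      by (rule span_minimal[rotated])
    have notin: "(g ^^ n) v \<notin> span (?K n)"
    proof
      assume "(g ^^ n) v \<in> span (?K n)"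
      with span obtain p where p: "(g ^^ n) v = poly_map p v" "\<forall>i\<ge>n. coeff p i = 0"
        by auto
      \<comment> \<open>As \<open>p\<close> has no term of degree \<open>n\<close>, the difference
        is a nonzero polynomial that annihilates \<open>v\<close>.\<close>
      have "coeff (monom 1 n - p) n = 1"
        using p(2) by simp
      then have "monom 1 n - p \<noteq> 0"
        by auto
      moreover have "poly_map (monom 1 n - p) v = 0"
        using p(1) by (simp add: poly_map_diff poly_map_monom)
      ultimately show False
        using contr by blast
    qed
    then have "(g ^^ n) v \<notin> ?K n"
      by (rule contrapos_nn) (rule span_base)
    moreover have "?K (Suc n) = insert ((g ^^ n) v) (?K n)"
      by (simp add: lessThan_Suc)
    moreover have "independent (insert ((g ^^ n) v) (?K n))"
      using notin Suc.IH by (intro independent_insertI) simp_all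
    ultimately show ?case
      using Suc.IH by (simp only: card_insert_disjoint finite_imageI finite_lessThan) simp
  qed
  from this[of "Suc (dim UNIV)"] show False
    using independent_card_le_dim[of "?K (Suc (dim UNIV))" UNIV] by simp
qed

text \<open>Polynomials in \<open>g\<close> commute, so the product of annihilating polynomials of
  the basis vectors kills every basis vector.\<close>

lemma exists_annihilating_poly: "\<exists>p. p \<noteq> 0 \<and> (\<forall>v. poly_map p v = 0)"
proof -
  have "\<exists>p. p \<noteq> 0 \<and> (\<forall>v\<in>B. poly_map p v = 0)" if "finite B" for B
    using that
  proof (induction B)
    case empty
    show ?case by (intro exI[of _ 1]) simp
  next
    case (insert b B)
    then obtain p where p: "p \<noteq> 0" "\<And>v. v \<in> B \<Longrightarrow> poly_map p v = 0"
      by blast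
    obtain q where q: "q \<noteq> 0" "poly_map q b = 0"
      using exists_annihilating_poly_at by blast
    have zero: "poly_map r 0 = 0" for r
      by (rule module_hom.zero[OF module_hom_linearI[OF linear_poly_map]])
    have "poly_map (p * q) b = 0"
      using q by (simp add: poly_map_mult zero)
    moreover have "poly_map (p * q) v = 0" if "v \<in> B" for v
      using p(2)[OF that] by (simp add: mult.commute[of p] poly_map_mult zero)
    ultimately show ?case
      using p(1) q(1) by (intro exI[of _ "p * q"]) auto
  qed
  from this[OF finite_Basis] obtain p where p: "p \<noteq> 0" "\<And>v. v \<in> Basis \<Longrightarrow> poly_map p v = 0"
    by blast
  have "poly_map p v = 0" for v
  proof (rule module_hom.eq_0_on_span[OF module_hom_linearI[OF linear_poly_map] p(2)])
    show "v \<in> span Basis"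
      by (simp add: span_Basis)
  qed
  with p(1) show ?thesis
    by blast
qed

end

section \<open>Commutators that are surjective on a subquotient\<close>

text \<open>Modulo \<open>U\<close>, the commutator of \<open>f\<close> with p(g) is p'(g) h. If
  p(g) maps \<open>M\<close> into \<open>U\<close>, then so does p'(g) h, and p'(g) too because
  \<open>h\<close> is onto. For nonzero \<open>p\<close> of least degree this forces
  \<open>p\<close> to be constant.\<close>

lemma commutator_not_surjective_mod:
  fixes scale :: "'f::field_char_0 \<Rightarrow> 'v::ab_group_add \<Rightarrow> 'v"
  assumes fd: "finite_dimensional_vector_space scale Basis"
    and f: "Vector_Spaces.linear scale scale f" and g: "Vector_Spaces.linear scale scale g"
    and h: "\<And>v. h v = f (g v) - g (f v)"
    and U: "module.subspace scale U" and M: "module.subspace scale M"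
    and fU: "\<And>v. v \<in> U \<Longrightarrow> f v \<in> U" and gU: "\<And>v. v \<in> U \<Longrightarrow> g v \<in> U"
    and fM: "\<And>v. v \<in> M \<Longrightarrow> f v \<in> M" and gM: "\<And>v. v \<in> M \<Longrightarrow> g v \<in> M"
    and comm: "\<And>v. v \<in> M \<Longrightarrow> h (g v) - g (h v) \<in> U"
    and surj: "\<And>v. v \<in> M \<Longrightarrow> \<exists>w\<in>M. v - h w \<in> U"
  shows "M \<subseteq> U"
proof -
  interpret finite_dimensional_linear_operator scale g Basis
    by (intro finite_dimensional_linear_operator.intro linear_operator.intro
        linear_operator_axioms.intro fd g finite_dimensional_vector_space.axioms(1)[OF fd])
  interpret f: Vector_Spaces.linear scale scale f by (fact f)
  note U_intros = subspace_add[OF U] subspace_scale[OF U] subspace_diff[OF U] subspace_0[OF U]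
  have hM: "h v \<in> M" if "v \<in> M" for v
    using that by (simp add: h fM gM subspace_diff[OF M])
  have h_hom: "h 0 = 0" "h (v + w) = h v + h w" "h (scale c v) = scale c (h v)" for c v w
    by (simp_all add: h f.add g.add f.scale g.scale algebra_simps)
  have pM: "poly_map p v \<in> M" if "v \<in> M" for p v
    using M gM that by (rule poly_map_in_subspace)
  have pU: "poly_map p v \<in> U" if "v \<in> U" for p v
    using U gU that by (rule poly_map_in_subspace)
  have hp: "h (poly_map p v) - poly_map p (h v) \<in> U" if v: "v \<in> M" for p v
  proof (induction p)
    case (pCons a p)
    let ?q = "poly_map p v"
    have "h (poly_map (pCons a p) v) - poly_map (pCons a p) (h v)
        = (h (g ?q) - g (h ?q)) + g (h ?q - poly_map p (h v))"
      by (simp add: poly_map_pCons h_hom g.diff)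
    also have "\<dots> \<in> U"
      by (intro U_intros comm gU pCons pM v)
    finally show ?case .
  qed (simp add: h_hom U_intros)
  \<comment> \<open>The derivative of \<open>pCons a p\<close> contributes an extra
    \<open>p\<close>, applied to \<open>h v\<close>; \<open>hp\<close> compares it with the term in
    which \<open>h\<close> comes last.\<close>
  have deriv: "f (poly_map p v) - poly_map p (f v) - poly_map (pderiv p) (h v) \<in> U"
    if v: "v \<in> M" for p v
  proof (induction p)
    case (pCons a p)
    let ?q = "poly_map p v"
    have "f (poly_map (pCons a p) v) - poly_map (pCons a p) (f v)
          - poly_map (pderiv (pCons a p)) (h v)
        = g (f ?q - poly_map p (f v) - poly_map (pderiv p) (h v))
          + (h ?q - poly_map p (h v))"
      by (simp add: poly_map_pCons pderiv_pCons poly_map_add f.add f.scale g.diff g.add h)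
    also have "\<dots> \<in> U"
      by (intro U_intros gU pCons hp v)
    finally show ?case .
  qed (simp add: U_intros)
  define A where "A p \<longleftrightarrow> p \<noteq> 0 \<and> (\<forall>v\<in>M. poly_map p v \<in> U)" for p
  obtain p0 where "A p0"
    using exists_annihilating_poly subspace_0[OF U] unfolding A_def by metis
  then obtain p where p: "A p" and min: "\<And>q. A q \<Longrightarrow> degree p \<le> degree q"
    using ex_has_least_nat[of A p0 degree] by blast
  have *: "poly_map (pderiv p) (h w) \<in> U" if w: "w \<in> M" for w
  proof -
    have "f (poly_map p w) - poly_map p (f w) \<in> U"
      using p w by (intro U_intros fU) (auto simp: A_def fM)
    from subspace_diff[OF U this deriv[OF w, of p]] show ?thesis
      by simp
  qed
  have "poly_map (pderiv p) v \<in> U" if v: "v \<in> M" for v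
  proof -
    obtain w where w: "w \<in> M" "v - h w \<in> U"
      using surj[OF v] by blast
    have "poly_map (pderiv p) (v - h w) + poly_map (pderiv p) (h w) \<in> U"
      by (intro U_intros pU * w)
    then show ?thesis
      by (simp add: module_hom.diff[OF module_hom_linearI[OF linear_poly_map]])
  qed
  \<comment> \<open>In characteristic zero, differentiation lowers a positive degree by exactly one
    and never yields zero, so minimality leaves degree 0 only.\<close>
  then have "pderiv p \<noteq> 0 \<Longrightarrow> degree p \<le> degree p - 1"
    using min[of "pderiv p"] by (simp add: A_def degree_pderiv)
  then have "degree p = 0"
    by (cases "degree p = 0") (simp_all add: pderiv_eq_0_iff)
  then obtain a where a: "p = [:a:]"
    by (auto elim: degree_eq_zeroE)
  with p have "a \<noteq> 0"
    by (auto simp: A_def)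
  show "M \<subseteq> U"
  proof
    fix v assume "v \<in> M"
    then have "scale a v \<in> U"
      using p a by (simp add: A_def poly_map_pCons)
    then have "scale (inverse a) (scale a v) \<in> U"
      by (rule subspace_scale[OF U])
    then show "v \<in> U"
      using \<open>a \<noteq> 0\<close> by simp
  qed
qed

section \<open>Ideals, right submodules and solvability\<close>

context right_leibniz_algebra
begin

notation bracket (infixl "\<cdot>" 70)

lemma bracket_simps:
  "(x + y) \<cdot> z = x \<cdot> z + y \<cdot> z" "(x - y) \<cdot> z = x \<cdot> z - y \<cdot> z" "0 \<cdot> z = 0"
  "scale c x \<cdot> z = scale c (x \<cdot> z)"
  "z \<cdot> (x + y) = z \<cdot> x + z \<cdot> y" "z \<cdot> (x - y) = z \<cdot> x - z \<cdot> y" "z \<cdot> 0 = 0"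
  "z \<cdot> scale c x = scale c (z \<cdot> x)"
proof -
  interpret left: Vector_Spaces.linear scale scale "\<lambda>x. x \<cdot> z"
    by (rule linear_left)
  interpret right: Vector_Spaces.linear scale scale "\<lambda>x. z \<cdot> x"
    by (rule linear_right)
  show "(x + y) \<cdot> z = x \<cdot> z + y \<cdot> z" "(x - y) \<cdot> z = x \<cdot> z - y \<cdot> z" "0 \<cdot> z = 0"
    "scale c x \<cdot> z = scale c (x \<cdot> z)"
    by (fact left.add left.diff left.zero left.scale)+
  show "z \<cdot> (x + y) = z \<cdot> x + z \<cdot> y" "z \<cdot> (x - y) = z \<cdot> x - z \<cdot> y" "z \<cdot> 0 = 0"
    "z \<cdot> scale c x = scale c (z \<cdot> x)"
    by (fact right.add right.diff right.zero right.scale)+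
qed

lemma bracket_bracket: "x \<cdot> y \<cdot> z = x \<cdot> z \<cdot> y + x \<cdot> (y \<cdot> z)"
  by (simp add: leibniz)

text \<open>Together with \<open>product_subset\<close>, this reduces stability of a product under
  multiplication to its generators.\<close>

lemma subspace_bracket_preimage:
  assumes "subspace T"
  shows "subspace {x. x \<cdot> v \<in> T}" "subspace {x. v \<cdot> x \<in> T}"
  using assms by (auto simp: subspace_def bracket_simps)

lemma bracket_in_product: "a \<in> A \<Longrightarrow> c \<in> C \<Longrightarrow> a \<cdot> c \<in> product A C"
  unfolding product_def by (rule span_base) blast

lemma product_subset:
  assumes "subspace T" and "\<And>a c. a \<in> A \<Longrightarrow> c \<in> C \<Longrightarrow> a \<cdot> c \<in> T"
  shows "product A C \<subseteq> T"
  unfolding product_def using assms by (intro span_minimal) auto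

lemma subspace_product: "subspace (product A C)"
  by (simp add: product_def)

lemma product_mono: "A \<subseteq> B \<Longrightarrow> C \<subseteq> D \<Longrightarrow> product A C \<subseteq> product B D"
  by (rule product_subset[OF subspace_product]) (auto intro: bracket_in_product)

lemma ideal_subspace: "ideal A \<Longrightarrow> subspace A"
  by (simp add: ideal_def)

lemma ideal_bracket: "ideal A \<Longrightarrow> a \<in> A \<Longrightarrow> a \<cdot> x \<in> A" "ideal A \<Longrightarrow> a \<in> A \<Longrightarrow> x \<cdot> a \<in> A"
  by (auto simp: ideal_def)

lemma ideal_sum:
  assumes "ideal A" "ideal B"
  shows "ideal {a + b | a b. a \<in> A \<and> b \<in> B}"
  unfolding ideal_def
proof (intro conjI ballI allI)
  show "subspace {a + b | a b. a \<in> A \<and> b \<in> B}"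
    using assms by (intro subspace_sums ideal_subspace)
qed (use assms in \<open>(auto simp: bracket_simps; blast intro: ideal_bracket)+\<close>)

definition right_submodule :: "'v set \<Rightarrow> bool" where
  "right_submodule M \<longleftrightarrow> subspace M \<and> (\<forall>v\<in>M. \<forall>x. v \<cdot> x \<in> M)"

lemma right_submodule_subspace: "right_submodule M \<Longrightarrow> subspace M"
  by (simp add: right_submodule_def)

lemma right_submodule_bracket: "right_submodule M \<Longrightarrow> v \<in> M \<Longrightarrow> v \<cdot> x \<in> M"
  by (simp add: right_submodule_def)

lemma right_submodule_ideal: "ideal A \<Longrightarrow> right_submodule A"
  by (simp add: right_submodule_def ideal_def)

lemma right_submodule_sum:
  assumes "right_submodule A" "right_submodule B"
  shows "right_submodule {a + b | a b. a \<in> A \<and> b \<in> B}"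
  unfolding right_submodule_def
proof (intro conjI ballI allI)
  show "subspace {a + b | a b. a \<in> A \<and> b \<in> B}"
    using assms by (intro subspace_sums right_submodule_subspace)
qed (use assms in \<open>auto simp: bracket_simps; blast intro: right_submodule_bracket\<close>)

text \<open>On generators, (m a) x = (m x) a + m (a x), and both terms are again products of
  \<open>M\<close> and \<open>A\<close>.\<close>

lemma right_submodule_product:
  assumes M: "right_submodule M" and A: "ideal A"
  shows "right_submodule (product M A)"
  unfolding right_submodule_def
proof (intro conjI ballI allI)
  fix v x assume "v \<in> product M A"
  moreover have "product M A \<subseteq> {v. v \<cdot> x \<in> product M A}"
  proof (intro product_subset subspace_bracket_preimage subspace_product, clarify)
    fix m a assume "m \<in> M" "a \<in> A"
    then show "m \<cdot> a \<cdot> x \<in> product M A"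
      unfolding bracket_bracket[of m a x] using M A
      by (intro subspace_add[OF subspace_product] bracket_in_product
          right_submodule_bracket ideal_bracket)
  qed
  ultimately show "v \<cdot> x \<in> product M A"
    by blast
qed (rule subspace_product)

lemma idealI_product:
  assumes "ideal A" "right_submodule B"
    and "\<And>x b a. b \<in> B \<Longrightarrow> a \<in> A \<Longrightarrow> x \<cdot> (b \<cdot> a) \<in> product B A"
  shows "ideal (product B A)"
proof -
  have "product B A \<subseteq> {v. x \<cdot> v \<in> product B A}" for x
    by (intro product_subset subspace_bracket_preimage subspace_product)
       (use assms(3) in blast)
  then show ?thesis
    using right_submodule_product[OF assms(2,1)]
    by (auto simp: ideal_def right_submodule_def)
qed

text \<open>Left stability follows from x (b a) = (x b) a - (x a) b.\<close>

lemma ideal_product_self: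
  assumes A: "ideal A"
  shows "ideal (product A A)"
proof (rule idealI_product[OF A right_submodule_ideal[OF A]])
  fix x b a assume "b \<in> A" "a \<in> A"
  then show "x \<cdot> (b \<cdot> a) \<in> product A A"
    unfolding leibniz[of x b a] using A
    by (intro subspace_diff[OF subspace_product] bracket_in_product ideal_bracket(2))
qed

lemma ideal_product_UNIV:
  assumes A: "ideal A"
  shows "ideal (product UNIV A)"
proof (rule idealI_product[OF A])
  show "right_submodule UNIV"
    by (simp add: right_submodule_def)
qed (use A in \<open>auto intro: bracket_in_product ideal_bracket\<close>)

lemma product_ideal_subset: "ideal A \<Longrightarrow> product B A \<subseteq> A"
  by (intro product_subset ideal_subspace ideal_bracket)

lemma ideal_derived_series: "ideal A \<Longrightarrow> ideal (derived_series A k)"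
  by (induction k) (simp_all add: ideal_product_self)

lemma derived_series_mono: "A \<subseteq> B \<Longrightarrow> derived_series A k \<subseteq> derived_series B k"
  by (induction k) (simp_all add: product_mono)

lemma derived_series_add:
  "derived_series A (m + n) = derived_series (derived_series A m) n"
  by (induction n) simp_all

lemma solvable_subset:
  assumes "ideal A" "A \<subseteq> B" "solvable B"
  shows "solvable A"
proof -
  obtain n where "derived_series B n = {0}"
    using assms(3) by (auto simp: solvable_def)
  then have "derived_series A n \<subseteq> {0}"
    using derived_series_mono[OF assms(2)] by metis
  then show ?thesis
    using ideal_subspace[OF ideal_derived_series[OF assms(1)], of n] subspace_0
    unfolding solvable_def by blast
qed

text \<open>The derived series of the sum stays inside the sum of \<open>B\<close> and the derived
  series of \<open>A\<close>. Once the latter vanishes it lies in \<open>B\<close>, and it then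
  descends with the derived series of \<open>B\<close>.\<close>

lemma solvable_sum:
  assumes A: "ideal A" "solvable A" and B: "ideal B" "solvable B"
  shows "solvable {a + b | a b. a \<in> A \<and> b \<in> B}" (is "solvable ?S")
proof -
  have *: "derived_series ?S k \<subseteq> {a + b | a b. a \<in> derived_series A k \<and> b \<in> B}" for k
  proof (induction k)
    case (Suc k)
    let ?D = "derived_series A k"
    have "product {a + b | a b. a \<in> ?D \<and> b \<in> B} {a + b | a b. a \<in> ?D \<and> b \<in> B}
        \<subseteq> {a + b | a b. a \<in> product ?D ?D \<and> b \<in> B}"
    proof (intro product_subset subspace_sums subspace_product ideal_subspace B, clarify)
      fix a b a' b' assume a: "a \<in> ?D" "a' \<in> ?D" and b: "b \<in> B" "b' \<in> B"
      \<comment> \<open>Of the four products only the first can lie outside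
        \<open>B\<close>.\<close>
      have "(a + b) \<cdot> (a' + b') = a \<cdot> a' + (a \<cdot> b' + (b \<cdot> a' + b \<cdot> b'))"
        by (simp add: bracket_simps add.assoc)
      moreover have "a \<cdot> b' + (b \<cdot> a' + b \<cdot> b') \<in> B"
        using b by (intro subspace_add[OF ideal_subspace] ideal_bracket B)
      ultimately show "\<exists>d e. (a + b) \<cdot> (a' + b') = d + e \<and> d \<in> product ?D ?D \<and> e \<in> B"
        using bracket_in_product[OF a] by blast
    qed
    with product_mono[OF Suc.IH Suc.IH] show ?case
      by simp
  qed simp
  obtain m n where m: "derived_series A m = {0}" and n: "derived_series B n = {0}"
    using A B by (auto simp: solvable_def)
  have "derived_series ?S m \<subseteq> B"
    using *[of m] by (auto simp: m)
  then have "derived_series ?S (m + n) \<subseteq> {0}"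
    unfolding derived_series_add n[symmetric] by (rule derived_series_mono)
  moreover have "0 \<in> derived_series ?S (m + n)"
    by (intro subspace_0 ideal_subspace ideal_derived_series ideal_sum A B)
  ultimately show ?thesis
    unfolding solvable_def by blast
qed

section \<open>Composition factors and images modulo a submodule\<close>

text \<open>A composition factor stands for the simple right module \<open>M/U\<close>.\<close>

definition composition_factor :: "'v set \<Rightarrow> 'v set \<Rightarrow> bool" where
  "composition_factor U M \<longleftrightarrow> right_submodule U \<and> right_submodule M \<and> U \<subset> M \<and>
     (\<forall>X. right_submodule X \<longrightarrow> U \<subseteq> X \<longrightarrow> X \<subseteq> M \<longrightarrow> X = U \<or> X = M)"

definition annihilator :: "'v set \<Rightarrow> 'v set \<Rightarrow> 'v set" where
  "annihilator U M = {x. \<forall>v\<in>M. v \<cdot> x \<in> U}"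

lemma ideal_annihilator:
  assumes U: "right_submodule U" and M: "right_submodule M"
  shows "ideal (annihilator U M)"
  unfolding ideal_def
proof (intro conjI ballI allI)
  note U_subspace = right_submodule_subspace[OF U]
  show "subspace (annihilator U M)"
    using U_subspace by (auto simp: annihilator_def subspace_def bracket_simps)
  fix a x assume a: "a \<in> annihilator U M"
  have 1: "v \<cdot> a \<cdot> x \<in> U" "v \<cdot> x \<cdot> a \<in> U" if "v \<in> M" for v
    using a that right_submodule_bracket[OF U] right_submodule_bracket[OF M]
    by (auto simp: annihilator_def)
  show "a \<cdot> x \<in> annihilator U M" "x \<cdot> a \<in> annihilator U M"
    by (auto simp: annihilator_def leibniz[of _ a x] leibniz[of _ x a]
        intro!: subspace_diff[OF U_subspace] 1)
qed

text \<open>The image of \<open>X\<close> modulo \<open>U\<close> under right multiplication by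
  \<open>c\<close>, pulled back by adding \<open>U\<close>. Subquotients are thus handled as
  subspaces of the algebra.\<close>

definition image_mod :: "'v set \<Rightarrow> 'v \<Rightarrow> 'v set \<Rightarrow> 'v set" where
  "image_mod U c X = {w \<cdot> c + u | w u. w \<in> X \<and> u \<in> U}"

lemma image_mod_mono: "X \<subseteq> Y \<Longrightarrow> image_mod U c X \<subseteq> image_mod U c Y"
  by (auto simp: image_mod_def)

lemma image_modI: "w \<in> X \<Longrightarrow> u \<in> U \<Longrightarrow> w \<cdot> c + u \<in> image_mod U c X"
  by (auto simp: image_mod_def)

lemma image_mod_bracket: "subspace U \<Longrightarrow> w \<in> X \<Longrightarrow> w \<cdot> c \<in> image_mod U c X"
  using image_modI[of w X 0 U c] subspace_0 by simp

lemma subset_image_mod: "subspace X \<Longrightarrow> U \<subseteq> image_mod U c X"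
  using image_modI[of 0 X _ U c] subspace_0 by (force simp: bracket_simps)

lemma subspace_image_mod:
  assumes "subspace U" "subspace X"
  shows "subspace (image_mod U c X)"
proof -
  have "subspace ((\<lambda>w. w \<cdot> c) ` X)"
    using module_hom_linearI[OF linear_left] assms(2) by (rule module_hom.subspace_image)
  from subspace_sums[OF this assms(1)] show ?thesis
    by (rule back_subst[of subspace]) (auto simp: image_mod_def)
qed

lemma image_mod_subset:
  assumes "subspace X" "U \<subseteq> X" "\<And>w. w \<in> X \<Longrightarrow> w \<cdot> c \<in> X"
  shows "image_mod U c X \<subseteq> X"
  using assms by (auto simp: image_mod_def intro!: subspace_add)

text \<open>
  The identity \<open>(w c + u) y = (w y) c + w [c, y] + u y\<close> shows how far the image of \<open>c\<close> is
  from being stable under \<open>y\<close>.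
\<close>

lemma image_mod_invariant:
  assumes "right_submodule U" "subspace X"
    and "v \<in> image_mod U c X" and "\<And>w. w \<in> X \<Longrightarrow> w \<cdot> y \<in> Y"
    and "\<And>w. w \<in> X \<Longrightarrow> w \<cdot> (c \<cdot> y) \<in> image_mod U c Y" and "subspace Y"
  shows "v \<cdot> y \<in> image_mod U c Y"
proof -
  note U = right_submodule_subspace[OF assms(1)]
  obtain w u where w: "v = w \<cdot> c + u" "w \<in> X" "u \<in> U"
    using assms(3) by (auto simp: image_mod_def)
  have "v \<cdot> y = (w \<cdot> y \<cdot> c + u \<cdot> y) + w \<cdot> (c \<cdot> y)"
    by (simp add: w(1) bracket_simps bracket_bracket[of w c y] ac_simps)
  also have "\<dots> \<in> image_mod U c Y"
    using w by (intro subspace_add[OF subspace_image_mod[OF U]] image_modI assms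
        right_submodule_bracket[OF assms(1)])
  finally show ?thesis .
qed

end

section \<open>Finite dimension: chains and extremal subspaces\<close>

locale finite_dimensional_right_leibniz_algebra =
  right_leibniz_algebra scale bracket + finite_dimensional_vector_space scale Basis
  for scale :: "'f::field_char_0 \<Rightarrow> 'v::ab_group_add \<Rightarrow> 'v"
    and bracket :: "'v \<Rightarrow> 'v \<Rightarrow> 'v" (infixl "\<cdot>" 70)
    and Basis :: "'v set"
begin

text \<open>At an index of least dimension the next inclusion is an equality.\<close>

lemma subspace_decreasing_stabilizes:
  assumes "\<And>n. subspace (X n)" and "\<And>n. X (Suc n) \<subseteq> X n"
  shows "\<exists>n. X (Suc n) = X n"
proof -
  obtain n where n: "\<And>m. dim (X n) \<le> dim (X m)"
    using ex_has_least_nat[of "\<lambda>_. True" undefined "\<lambda>n. dim (X n)"] by blast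
  show ?thesis
    using subspace_dim_equal[OF assms(1) assms(1) assms(2) n] by blast
qed

lemma subspace_max_dim:
  assumes "P X0" and "\<And>X. P X \<Longrightarrow> subspace X"
  obtains X where "P X" and "\<And>Y. P Y \<Longrightarrow> X \<subseteq> Y \<Longrightarrow> Y = X"
proof -
  obtain X where X: "P X" "\<And>Y. P Y \<Longrightarrow> dim Y \<le> dim X"
    using ex_has_greatest_nat[of P X0 dim "Suc dimension"] assms(1) dim_subset_UNIV
    by (auto simp: less_Suc_eq_le)
  show thesis
  proof (rule that[OF X(1)])
    fix Y assume Y: "P Y" "X \<subseteq> Y"
    show "Y = X"
      by (rule subspace_dim_equal[symmetric]) (intro assms(2) X Y)+
  qed
qed

lemma subspace_min_dim:
  assumes "P X0" and "\<And>X. P X \<Longrightarrow> subspace X"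
  obtains X where "P X" and "\<And>Y. P Y \<Longrightarrow> Y \<subseteq> X \<Longrightarrow> Y = X"
proof -
  obtain X where X: "P X" "\<And>Y. P Y \<Longrightarrow> dim X \<le> dim Y"
    using ex_has_least_nat[of P X0 dim] assms(1) by blast
  show thesis
  proof (rule that[OF X(1)])
    fix Y assume Y: "P Y" "Y \<subseteq> X"
    show "Y = X"
      by (rule subspace_dim_equal) (intro assms(2) X Y)+
  qed
qed

section \<open>Action of ideals on composition factors\<close>

text \<open>By the Leibniz identity, \<open>y \<cdot> z\<close> acts as the commutator of right
  multiplication by \<open>z\<close> with that by \<open>y\<close>. By \<open>comm\<close> it
  commutes with \<open>y\<close> modulo \<open>U\<close>, so the result on surjective commutators
  applies.\<close>

lemma image_mod_bracket_proper:
  assumes U: "right_submodule U" and M: "right_submodule M"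
    and comm: "\<And>v. v \<in> M \<Longrightarrow> v \<cdot> (y \<cdot> z \<cdot> y) \<in> U"
    and surj: "image_mod U (y \<cdot> z) M = M"
  shows "M \<subseteq> U"
proof (rule commutator_not_surjective_mod[of scale Basis "\<lambda>v. v \<cdot> z" "\<lambda>v. v \<cdot> y" "\<lambda>v. v \<cdot> (y \<cdot> z)"])
  show "v \<cdot> y \<cdot> (y \<cdot> z) - v \<cdot> (y \<cdot> z) \<cdot> y \<in> U" if "v \<in> M" for v
    using subspace_neg[OF right_submodule_subspace[OF U] comm[OF that]]
    by (simp add: leibniz[of v "y \<cdot> z" y])
  show "\<exists>w\<in>M. v - w \<cdot> (y \<cdot> z) \<in> U" if "v \<in> M" for v
  proof -
    have "v \<in> image_mod U (y \<cdot> z) M"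
      using that surj by simp
    then obtain w u where "v = w \<cdot> (y \<cdot> z) + u" "w \<in> M" "u \<in> U"
      by (auto simp: image_mod_def)
    then show ?thesis
      by (intro bexI[of _ w]) simp_all
  qed
qed (auto intro: leibniz linear_left finite_dimensional_vector_space_axioms
      right_submodule_subspace right_submodule_bracket U M)

text \<open>A central action has a submodule as its image. By simplicity the image is
  \<open>U\<close> or \<open>M\<close>, and \<open>M\<close> is excluded because the element is a
  bracket.\<close>

lemma central_bracket_in_annihilator:
  assumes F: "composition_factor U M"
    and central: "\<And>x. y \<cdot> z \<cdot> x \<in> annihilator U M"
  shows "y \<cdot> z \<in> annihilator U M"
proof -
  let ?I = "image_mod U (y \<cdot> z) M"
  have U: "right_submodule U" and M: "right_submodule M" and UM: "U \<subseteq> M" "\<not> M \<subseteq> U"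
    using F by (auto simp: composition_factor_def)
  note sub = right_submodule_subspace[OF U] right_submodule_subspace[OF M]
  have UI: "U \<subseteq> ?I"
    by (rule subset_image_mod[OF sub(2)])
  have "right_submodule ?I"
    unfolding right_submodule_def
  proof (intro conjI ballI allI)
    fix v x assume "v \<in> ?I"
    with U sub(2) show "v \<cdot> x \<in> ?I"
    proof (rule image_mod_invariant)
      show "w \<cdot> (y \<cdot> z \<cdot> x) \<in> ?I" if "w \<in> M" for w
        using central[of x] that UI by (auto simp: annihilator_def)
    qed (auto intro: right_submodule_bracket M sub)
  qed (intro subspace_image_mod sub)
  moreover have "?I \<subseteq> M"
    by (intro image_mod_subset sub UM right_submodule_bracket[OF M])
  moreover have "?I \<noteq> M"
    using image_mod_bracket_proper[OF U M] central UM(2) by (auto simp: annihilator_def)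
  ultimately have "?I = U"
    using F UI by (auto simp: composition_factor_def)
  then show ?thesis
    using image_mod_bracket[OF sub(1), of _ M "y \<cdot> z"] by (auto simp: annihilator_def)
qed

text \<open>
  The images of the powers of \<open>c = [a, x]\<close> modulo \<open>U\<close> decrease to a submodule on which \<open>c\<close>
  is surjective, so \<open>c\<close> acts nilpotently on \<open>M/U\<close>.
\<close>

lemma nilpotent_bracket_mod:
  assumes F: "composition_factor U M" and A: "ideal A"
    and abelian: "\<And>a b. a \<in> A \<Longrightarrow> b \<in> A \<Longrightarrow> a \<cdot> b \<in> annihilator U M"
    and a: "a \<in> A"
  shows "\<exists>n. (image_mod U (a \<cdot> x) ^^ n) M = U"
proof -
  have U: "right_submodule U" and M: "right_submodule M" and UM: "U \<subseteq> M" "\<not> M \<subseteq> U"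
    using F by (auto simp: composition_factor_def)
  note sub = right_submodule_subspace[OF U] right_submodule_subspace[OF M]
  let ?c = "a \<cdot> x"
  have c: "?c \<in> A"
    using a by (rule ideal_bracket[OF A])
  define X where "X n = (image_mod U ?c ^^ n) M" for n
  have X_simps: "X 0 = M" "X (Suc n) = image_mod U ?c (X n)" for n
    by (simp_all add: X_def)
  have X_sub: "subspace (X n)" for n
    by (induction n) (simp_all add: X_simps subspace_image_mod sub)
  have X_Suc: "X (Suc n) \<subseteq> X n" for n
  proof (induction n)
    case 0
    show ?case
      unfolding X_simps by (intro image_mod_subset sub UM right_submodule_bracket[OF M])
  next
    case (Suc n)
    from image_mod_mono[OF this] show ?case
      by (simp add: X_simps)
  qed
  have XM: "X n \<subseteq> M" for n
    by (induction n) (use X_Suc in \<open>auto simp: X_simps\<close>)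
  have UX: "U \<subseteq> X n" for n
    by (cases n) (auto simp: X_simps UM(1) subset_image_mod[OF X_sub, THEN subsetD])
  \<comment> \<open>For \<open>b\<close> in \<open>A\<close> the element \<open>?c \<cdot> b\<close>
    kills \<open>M\<close> modulo \<open>U\<close>, so \<open>b\<close> commutes with
    \<open>?c\<close> there and preserves every iterated image.\<close>
  have XA: "v \<cdot> b \<in> X n" if "v \<in> X n" "b \<in> A" for v b n
    using that(1)
  proof (induction n arbitrary: v)
    case 0
    then show ?case
      by (simp add: X_simps right_submodule_bracket[OF M])
  next
    case (Suc n)
    from U X_sub[of n] Suc.prems[unfolded X_simps] have "v \<cdot> b \<in> image_mod U ?c (X n)"
    proof (rule image_mod_invariant)
      fix w assume w: "w \<in> X n"
      then show "w \<cdot> b \<in> X n"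
        by (rule Suc.IH)
      have "w \<cdot> (?c \<cdot> b) \<in> U"
        using abelian[OF c that(2)] w XM by (auto simp: annihilator_def)
      then show "w \<cdot> (?c \<cdot> b) \<in> image_mod U ?c (X n)"
        using subset_image_mod[OF X_sub] by blast
    qed (rule X_sub)
    then show ?case
      by (simp add: X_simps)
  qed
  \<comment> \<open>An arbitrary \<open>y\<close> costs one step of the chain: the correction term
    involves \<open>?c \<cdot> y\<close>, which lies in \<open>A\<close> and so preserves the
    images. Where the chain is stationary, it is therefore a submodule.\<close>
  have X_bracket: "v \<cdot> y \<in> X n" if "v \<in> X (Suc n)" for v y n
    using that
  proof (induction n arbitrary: v)
    case 0
    then have "v \<in> M"
      using X_Suc[of 0] by (auto simp: X_simps(1))
    then show ?case
      by (simp add: X_simps right_submodule_bracket[OF M])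
  next
    case (Suc n)
    from U X_sub[of "Suc n"] Suc.prems[unfolded X_simps(2)[of "Suc n"]]
    have "v \<cdot> y \<in> image_mod U ?c (X n)"
    proof (rule image_mod_invariant)
      fix w assume w: "w \<in> X (Suc n)"
      then show "w \<cdot> y \<in> X n"
        by (rule Suc.IH)
      show "w \<cdot> (?c \<cdot> y) \<in> image_mod U ?c (X n)"
        using XA[OF w ideal_bracket(1)[OF A c]] by (simp add: X_simps)
    qed (rule X_sub)
    then show ?case
      by (simp add: X_simps)
  qed
  obtain n where n: "X (Suc n) = X n"
    using subspace_decreasing_stabilizes[of X] X_sub X_Suc by blast
  have "right_submodule (X n)"
    using X_sub X_bracket[of _ n] by (auto simp: right_submodule_def n)
  then have "X n = U \<or> X n = M"
    using F UX XM by (auto simp: composition_factor_def)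
  moreover have "X n \<noteq> M"
  proof
    assume "X n = M"
    with n have surj: "image_mod U ?c M = M"
      by (simp add: X_simps)
    have "M \<subseteq> U"
      using U M _ surj
      by (rule image_mod_bracket_proper) (use abelian[OF c a] in \<open>auto simp: annihilator_def\<close>)
    with UM(2) show False ..
  qed
  ultimately show ?thesis
    unfolding X_def by blast
qed

text \<open>
  The elements \<open>[a, x]\<close> act on \<open>M/U\<close> by commuting nilpotent maps, hence have a common kernel,
  and this kernel is a submodule.
\<close>

lemma bracket_abelian_ideal_in_annihilator:
  assumes F: "composition_factor U M" and A: "ideal A"
    and abelian: "\<And>a b. a \<in> A \<Longrightarrow> b \<in> A \<Longrightarrow> a \<cdot> b \<in> annihilator U M"
    and a: "a \<in> A"
  shows "a \<cdot> x \<in> annihilator U M"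
proof -
  have U: "right_submodule U" and M: "right_submodule M" and UM: "U \<subset> M"
    using F by (auto simp: composition_factor_def)
  note sub = right_submodule_subspace[OF U] right_submodule_subspace[OF M]
  \<comment> \<open>A minimal \<open>S\<close> with this property represents a simple
    \<open>A\<close>-submodule of M/U.\<close>
  define P where "P S \<longleftrightarrow> subspace S \<and> U \<subset> S \<and> S \<subseteq> M \<and> (\<forall>s\<in>S. \<forall>b\<in>A. s \<cdot> b \<in> S)" for S
  have "P M"
    using UM sub by (auto simp: P_def right_submodule_bracket[OF M])
  then obtain S where S: "P S" and min: "\<And>Y. P Y \<Longrightarrow> Y \<subseteq> S \<Longrightarrow> Y = S"
    by (rule subspace_min_dim) (auto simp: P_def)
  have S_sub: "subspace S" and US: "U \<subset> S" and SM: "S \<subseteq> M"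
    and SA: "\<And>s b. s \<in> S \<Longrightarrow> b \<in> A \<Longrightarrow> s \<cdot> b \<in> S"
    using S by (auto simp: P_def)
  have kill: "s \<cdot> (b \<cdot> y) \<in> U" if s: "s \<in> S" and b: "b \<in> A" for s b y
  proof -
    let ?c = "b \<cdot> y"
    let ?I = "image_mod U ?c S"
    have c: "?c \<in> A"
      using b by (rule ideal_bracket[OF A])
    have UI: "U \<subseteq> ?I"
      by (rule subset_image_mod[OF S_sub])
    have IS: "?I \<subseteq> S"
      using US by (intro image_mod_subset S_sub SA c) auto
    \<comment> \<open>If \<open>?c\<close> were onto modulo \<open>U\<close>, then \<open>S\<close>
      would lie in all iterated images of \<open>M\<close>, one of which is
      \<open>U\<close>.\<close>
    have "?I \<noteq> S"
    proof
      assume I: "?I = S"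
      have "S \<subseteq> (image_mod U ?c ^^ n) M" for n
      proof (induction n)
        case (Suc n)
        from image_mod_mono[OF this, of U ?c] show ?case
          by (simp add: I)
      qed (simp add: SM)
      moreover obtain n where "(image_mod U ?c ^^ n) M = U"
        using nilpotent_bracket_mod[OF F A abelian b] by blast
      ultimately show False
        using US by blast
    qed
    moreover have "v \<cdot> d \<in> ?I" if "v \<in> ?I" "d \<in> A" for v d
      using U S_sub that(1)
    proof (rule image_mod_invariant)
      show "w \<cdot> (?c \<cdot> d) \<in> ?I" if "w \<in> S" for w
        using abelian[OF c \<open>d \<in> A\<close>] that SM UI by (auto simp: annihilator_def)
    qed (auto intro: SA S_sub \<open>d \<in> A\<close>)
    ultimately have "?I = U"
      using min[of ?I] UI IS SM subspace_image_mod[OF sub(1) S_sub]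
      unfolding P_def by blast
    with image_mod_bracket[OF sub(1) s] show ?thesis
      by blast
  qed
  define Z where "Z = {v \<in> M. \<forall>b\<in>A. \<forall>y. v \<cdot> (b \<cdot> y) \<in> U}"
  have "right_submodule Z"
    unfolding right_submodule_def
  proof (intro conjI ballI allI)
    show "subspace Z"
      using sub by (auto simp: Z_def subspace_def bracket_simps)
    fix v y assume v: "v \<in> Z"
    have "v \<cdot> y \<cdot> (b \<cdot> z) \<in> U" if b: "b \<in> A" for b z
    proof -
      \<comment> \<open>Since \<open>b \<cdot> z\<close> is in \<open>A\<close>, the element
        \<open>b \<cdot> z \<cdot> y\<close> is again a bracket of the kind that \<open>Z\<close>
        kills.\<close>
      have "v \<cdot> y \<cdot> (b \<cdot> z) = v \<cdot> (b \<cdot> z) \<cdot> y - v \<cdot> (b \<cdot> z \<cdot> y)"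
        by (simp add: leibniz[of v "b \<cdot> z" y])
      also have "\<dots> \<in> U"
      proof (rule subspace_diff[OF sub(1)])
        show "v \<cdot> (b \<cdot> z) \<cdot> y \<in> U"
          by (rule right_submodule_bracket[OF U]) (use v b in \<open>auto simp: Z_def\<close>)
        show "v \<cdot> (b \<cdot> z \<cdot> y) \<in> U"
          using v ideal_bracket(1)[OF A b] by (auto simp: Z_def)
      qed
      finally show ?thesis .
    qed
    with v show "v \<cdot> y \<in> Z"
      by (auto simp: Z_def right_submodule_bracket[OF M])
  qed
  moreover have "S \<subseteq> Z"
    using kill SM by (auto simp: Z_def)
  moreover have "Z \<subseteq> M"
    by (auto simp: Z_def)
  ultimately have "Z = M"
    using F US unfolding composition_factor_def by blast
  then show ?thesis
    using a by (auto simp: Z_def annihilator_def)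
qed

text \<open>Annihilation climbs the derived series of [L, R] from its zero term to the top. Every
  term is spanned by products, including the top one, so the result on central brackets reaches its
  generators.\<close>

theorem product_UNIV_solvable_ideal_subset_annihilator:
  assumes F: "composition_factor U M" and R: "ideal R" "solvable R"
  shows "product UNIV R \<subseteq> annihilator U M"
proof -
  let ?I = "product UNIV R" and ?K = "annihilator U M"
  let ?D = "derived_series ?I"
  have I: "ideal ?I"
    by (rule ideal_product_UNIV[OF R(1)])
  have K: "ideal ?K"
    using F by (auto simp: composition_factor_def intro: ideal_annihilator)
  note K_sub = ideal_subspace[OF K]
  have step: "?D k \<subseteq> ?K" if IH: "?D (Suc k) \<subseteq> ?K" for k
  proof -
    have D: "ideal (?D k)"
      by (rule ideal_derived_series[OF I])
    have central: "a \<cdot> x \<in> ?K" if "a \<in> ?D k" for a x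
      using F D _ that
      by (rule bracket_abelian_ideal_in_annihilator)
         (use IH bracket_in_product in fastforce)
    have "y \<cdot> z \<in> ?K" if "y \<cdot> z \<in> ?D k" for y z
      by (rule central_bracket_in_annihilator[OF F central[OF that]])
    \<comment> \<open>Stated for any \<open>B\<close> and \<open>C\<close> to cover both the top
      term and the squares that follow it.\<close>
    then have "product B C \<subseteq> ?K" if "?D k = product B C" for B C
      using that bracket_in_product by (intro product_subset K_sub) blast
    then show ?thesis
      by (cases k) auto
  qed
  have "solvable ?I"
    using I product_ideal_subset[OF R(1)] R(2) by (rule solvable_subset)
  then obtain n where "?D n = {0}"
    by (auto simp: solvable_def)
  then have "?D n \<subseteq> ?K"
    using subspace_0[OF K_sub] by simp
  \<comment> \<open>Induction on \<open>n\<close> carries the inclusion back from index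
    \<open>n\<close> to index 0.\<close>
  then have "?D 0 \<subseteq> ?K"
    by (induction n) (use step in blast)+
  then show ?thesis
    by simp
qed

section \<open>Nilpotency, the nilradical and the radical\<close>

lemma composition_factor_exists:
  assumes M: "right_submodule M" and "M \<noteq> {0}"
  shows "\<exists>U. composition_factor U M"
proof -
  have "right_submodule {0} \<and> {0} \<subset> M"
    using assms subspace_0[OF right_submodule_subspace[OF M]]
    by (auto simp: right_submodule_def bracket_simps)
  then obtain U where U: "right_submodule U \<and> U \<subset> M"
    and max: "\<And>Y. right_submodule Y \<and> Y \<subset> M \<Longrightarrow> U \<subseteq> Y \<Longrightarrow> Y = U"
    by (rule subspace_max_dim[of "\<lambda>U. right_submodule U \<and> U \<subset> M"])
       (auto intro: right_submodule_subspace)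
  then show ?thesis
    using M unfolding composition_factor_def by blast
qed

lemma right_submodule_lower_central_series:
  "ideal I \<Longrightarrow> right_submodule (lower_central_series I k)"
  by (induction k) (simp_all add: right_submodule_ideal right_submodule_product)

text \<open>If \<open>I\<close> does not kill M/U, simplicity gives M = U + M I, and iteration puts
  \<open>M\<close> into \<open>U\<close> plus any term of the lower central series. Conversely,
  where that series is stationary at some C = C I, a composition factor C/U killed by
  \<open>I\<close> would give C inside \<open>U\<close>.\<close>

lemma nilpotent_iff_subset_annihilators:
  assumes I: "ideal I"
  shows "nilpotent I \<longleftrightarrow> (\<forall>U M. composition_factor U M \<longrightarrow> I \<subseteq> annihilator U M)"
proof (intro iffI allI impI)
  fix U M assume "nilpotent I" and F: "composition_factor U M"
  then obtain n where n: "lower_central_series I n = {0}"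
    by (auto simp: nilpotent_def)
  have U: "right_submodule U" and M: "right_submodule M" and UM: "U \<subset> M"
    using F by (auto simp: composition_factor_def)
  note sub = right_submodule_subspace[OF U] right_submodule_subspace[OF M]
  let ?T = "\<lambda>B. {u + w | u w. u \<in> U \<and> w \<in> B}"
  have lcs: "right_submodule (lower_central_series I k)" for k
    by (rule right_submodule_lower_central_series[OF I])
  have P: "right_submodule (product M I)"
    by (rule right_submodule_product[OF M I])
  have UT: "U \<subseteq> ?T (product M I)"
    using subspace_0[OF subspace_product, of M I] by force
  have PT: "product M I \<subseteq> ?T (product M I)"
    using subspace_0[OF sub(1)] by force
  have "product M I \<subseteq> M"
    by (intro product_subset sub right_submodule_bracket[OF M])
  then have "?T (product M I) \<subseteq> M"
    using UM by (auto intro!: subspace_add sub)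
  then consider "?T (product M I) = U" | "?T (product M I) = M"
    using F UT right_submodule_sum[OF U P] unfolding composition_factor_def by blast
  then show "I \<subseteq> annihilator U M"
  proof cases
    case 1
    with PT bracket_in_product show ?thesis
      by (auto simp: annihilator_def)
  next
    case 2
    have *: "M \<subseteq> ?T (lower_central_series I k)" for k
    proof (induction k)
      case 0
      show ?case
        using 2 product_ideal_subset[OF I, of M] by simp blast
    next
      case (Suc k)
      have "product M I \<subseteq> ?T (lower_central_series I (Suc k))"
      proof (intro product_subset subspace_sums sub right_submodule_subspace[OF lcs], clarify)
        fix m i assume "m \<in> M" "i \<in> I"
        with Suc.IH obtain u w where m: "m = u + w" "u \<in> U" "w \<in> lower_central_series I k"
          by blast
        have "m \<cdot> i = u \<cdot> i + w \<cdot> i" "u \<cdot> i \<in> U" "w \<cdot> i \<in> lower_central_series I (Suc k)"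
          using m \<open>i \<in> I\<close>
          by (simp_all add: bracket_simps right_submodule_bracket[OF U] bracket_in_product)
        then show "\<exists>u w. m \<cdot> i = u + w \<and> u \<in> U \<and> w \<in> lower_central_series I (Suc k)"
          by blast
      qed
      moreover have "u + (u' + w) \<in> ?T B" if "u \<in> U" "u' \<in> U" "w \<in> B" for u u' w B
        using that subspace_add[OF sub(1) that(1,2)] by (auto simp flip: add.assoc)
      ultimately have "?T (product M I) \<subseteq> ?T (lower_central_series I (Suc k))"
        by blast
      with 2 show ?case
        by simp
    qed
    from *[of n] UM show ?thesis
      by (auto simp: n)
  qed
next
  assume ann: "\<forall>U M. composition_factor U M \<longrightarrow> I \<subseteq> annihilator U M"
  let ?C = "lower_central_series I"
  have C: "right_submodule (?C k)" for k
    by (rule right_submodule_lower_central_series[OF I])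
  have "?C (Suc k) \<subseteq> ?C k" for k
    unfolding lower_central_series.simps
    by (intro product_subset right_submodule_subspace[OF C] right_submodule_bracket[OF C])
  then obtain k where k: "?C (Suc k) = ?C k"
    using subspace_decreasing_stabilizes[of ?C] right_submodule_subspace[OF C] by blast
  have "?C k = {0}"
  proof (rule ccontr)
    assume "?C k \<noteq> {0}"
    then obtain U where F: "composition_factor U (?C k)"
      using composition_factor_exists[OF C] by blast
    then have "subspace U"
      by (auto simp: composition_factor_def right_submodule_subspace)
    then have "product (?C k) I \<subseteq> U"
      by (rule product_subset) (use ann F in \<open>auto simp: annihilator_def\<close>)
    with F k show False
      by (auto simp: composition_factor_def)
  qed
  then show "nilpotent I"
    by (auto simp: nilpotent_def)
qed

text \<open>The criterion makes this ideal nilpotent and an upper bound of all nilpotent ideals, so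
  the greatest one exists. With no composition factors the intersection is
  \<open>UNIV\<close>.\<close>

lemma nilradical_eq: "nilradical = (\<Inter>(U, M) \<in> {(U, M). composition_factor U M}. annihilator U M)"
  (is "_ = ?N")
  unfolding nilradical_def
proof (rule Greatest_equality)
  have "ideal (annihilator U M)" if "composition_factor U M" for U M
    using that by (auto simp: composition_factor_def intro: ideal_annihilator)
  then have N: "ideal ?N"
    unfolding ideal_def by (fastforce intro!: subspace_Inter)
  then show "ideal ?N \<and> nilpotent ?N"
    by (auto simp: nilpotent_iff_subset_annihilators)
next
  fix J assume "ideal J \<and> nilpotent J"
  then show "J \<subseteq> ?N"
    using nilpotent_iff_subset_annihilators[of J] by blast
qed

text \<open>A maximal solvable ideal absorbs every other one, because their sum is a solvable ideal.
  Hence \<open>GREATEST\<close> is attained and \<open>radical\<close> has its intended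
  value.\<close>

lemma radical_solvable_ideal: "ideal radical" "solvable radical"
proof -
  have "ideal {0} \<and> solvable {0}"
    by (auto simp: ideal_def solvable_def bracket_simps intro!: exI[of _ 0])
  then obtain R where R: "ideal R \<and> solvable R"
    and max: "\<And>J. ideal J \<and> solvable J \<Longrightarrow> R \<subseteq> J \<Longrightarrow> J = R"
    by (rule subspace_max_dim[of "\<lambda>I. ideal I \<and> solvable I"]) (auto intro: ideal_subspace)
  have "J \<subseteq> R" if J: "ideal J \<and> solvable J" for J
  proof -
    let ?S = "{a + b | a b. a \<in> R \<and> b \<in> J}"
    have "R \<subseteq> ?S" "J \<subseteq> ?S"
      using R J subspace_0[OF ideal_subspace] by force+
    moreover have "ideal ?S \<and> solvable ?S"
      using R J by (simp add: ideal_sum solvable_sum)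
    ultimately show ?thesis
      using max[of ?S] by blast
  qed
  then have "radical = R"
    unfolding radical_def using R by (intro Greatest_equality) auto
  with R show "ideal radical" "solvable radical"
    by auto
qed

theorem product_UNIV_radical_subset_nilradical: "product UNIV radical \<subseteq> nilradical"
  using product_UNIV_solvable_ideal_subset_annihilator[OF _ radical_solvable_ideal]
  by (auto simp: nilradical_eq)

end

theorem proposition3p1:
  fixes scale :: "'f::field_char_0 \<Rightarrow> 'v::ab_group_add \<Rightarrow> 'v"
    and bracket :: "'v \<Rightarrow> 'v \<Rightarrow> 'v"
    and Basis :: "'v set"
  assumes "right_leibniz_algebra scale bracket"
    and "finite_dimensional_vector_space scale Basis"
  shows "right_leibniz_algebra.product scale bracket UNIV
           (right_leibniz_algebra.radical scale bracket)
         \<subseteq> right_leibniz_algebra.nilradical scale bracket"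
proof -
  interpret finite_dimensional_right_leibniz_algebra scale bracket Basis
    by (intro finite_dimensional_right_leibniz_algebra.intro assms)
  show ?thesis
    by (rule product_UNIV_radical_subset_nilradical)
qed

end
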